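(* For each $n\ge 1$, the joint distribution of the statistics "number of even-to-odd matches" and "number of odd-to-even matches" on perfect matchings of $\{1,\dots,2n\}$ is the same as the joint distribution of the statistics "number of even entries that occur an odd number of times" and "number of odd entries that occur an odd number of times" on trapezoidal words of length $n$.
   Context: A perfect matching of $\{1,\dots,2n\}$ (of size $n$) is a partition of it into 2-element subsets (matches). An even-to-odd match is an even number matched to a larger odd number; an odd-to-even match is an odd number matched to a larger even number. A trapezoidal word of length $n$ is an element $(a_k)_{1\le k\le n}$ of $[1]\times[3]\times\cdots\times[2n-1]$, where $[m]=\{1,\dots,m\}$. The number of even (odd) entries that occur an odd number of times means the number of distinct even (odd) values that occur an odd number of times in the word. *)

theory Defs
  imports Main "HOL-Library.Disjoint_Sets"
begin

definition perfect_matchings :: "nat \<Rightarrow> nat set set set" where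
  "perfect_matchings n = {M. partition_on {1..2 * n} M \<and> (\<forall>e\<in>M. card e = 2)}"

definition even_to_odd_matches :: "nat set set \<Rightarrow> nat" where
  "even_to_odd_matches M = card {e \<in> M. \<exists>a b. e = {a, b} \<and> a < b \<and> even a \<and> odd b}"

definition odd_to_even_matches :: "nat set set \<Rightarrow> nat" where
  "odd_to_even_matches M = card {e \<in> M. \<exists>a b. e = {a, b} \<and> a < b \<and> odd a \<and> even b}"

text \<open>List positions start at 0, so the entry \<open>a\<^sub>k\<close> with \<open>1 \<le> k \<le> n\<close> of a word is
  \<open>w ! (k - 1)\<close>, and the bound \<open>2 k - 1\<close> at position \<open>k\<close> becomes \<open>2 * i + 1\<close> at index \<open>i = k - 1\<close>.\<close>

definition trapezoidal_words :: "nat \<Rightarrow> nat list set" where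
  "trapezoidal_words n = {w. length w = n \<and> (\<forall>i<n. w ! i \<in> {1..2 * i + 1})}"

definition even_entries_odd_times :: "nat list \<Rightarrow> nat" where
  "even_entries_odd_times w = card {v \<in> set w. even v \<and> odd (count_list w v)}"

definition odd_entries_odd_times :: "nat list \<Rightarrow> nat" where
  "odd_entries_odd_times w = card {v \<in> set w. odd v \<and> odd (count_list w v)}"

end

theory Submission
  imports Defs "HOL-Library.Multiset"
begin

text \<open>
  Both families grow in the same way, and their statistics evolve by the same law.  An object of
  size \<open>n\<close> has exactly \<open>2 * n + 1\<close> extensions to size \<open>n + 1\<close>, and if its statistics are \<open>(i, j)\<close>,
  then among these extensions \<open>i\<close> decrease the first statistic by one, \<open>n - i\<close> increase it,
  \<open>j\<close> decrease the second statistic and \<open>n + 1 - j\<close> increase it (\<open>transitions\<close>).  Since the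
  distribution at size \<open>n + 1\<close> is then determined by the one at size \<open>n\<close>
  (\<open>distribution_of_extension\<close>), the two distributions agree by induction on \<open>n\<close>.

  A word is extended by appending a letter \<open>c\<close> of \<open>{1..2 * n + 1}\<close>, which toggles whether \<open>c\<close> occurs
  an odd number of times.  Of the \<open>n\<close> even letters, \<open>i\<close> occur an odd number of times, and of the
  \<open>n + 1\<close> odd letters, \<open>j\<close> do; this is the law (\<open>word_transitions\<close>).

  A matching is extended by the points \<open>2 * n + 1\<close> and \<open>2 * n + 2\<close>: either they are matched to each
  other, or a match is split, with one end \<open>c\<close> going to \<open>2 * n + 1\<close> and the other end \<open>d\<close> to
  \<open>2 * n + 2\<close>.  The new matches \<open>{c, 2 * n + 1}\<close> and \<open>{d, 2 * n + 2}\<close> count as even-to-odd for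
  even \<open>c\<close>, respectively as odd-to-even for odd \<open>d\<close>.  Hence

  \<^item> \<open>c\<close> odd, \<open>d\<close> even: a mixed match is lost; there are \<open>i\<close> such \<open>c\<close> with \<open>d < c\<close>, and \<open>j\<close> with
    \<open>c < d\<close>;
  \<^item> \<open>c\<close> even, and not the smaller end of an even-to-odd match: the net effect is one more
    even-to-odd match, because for odd \<open>d < c\<close> the lost odd-to-even match is replaced; there are
    \<open>n - i\<close> such \<open>c\<close>;
  \<^item> in the remaining \<open>n + 1 - j\<close> cases (\<open>d\<close> odd, with \<open>c\<close> odd or \<open>c\<close> even and \<open>c < d\<close>; or the new
    points matched to each other) the net effect is one more odd-to-even match.

  This is the same law (\<open>matching_transitions\<close>).
\<close>

section \<open>Distributions generated by a common transition law\<close>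

text \<open>
  The multiset of statistics of the \<open>2 * n + 1\<close> extensions of an object of size \<open>n\<close> with
  statistics \<open>(i, j)\<close>.  The truncated \<open>i - 1\<close> and \<open>j - 1\<close> are harmless: they occur with
  multiplicity \<open>i\<close> and \<open>j\<close>.
\<close>

definition transitions :: "nat \<Rightarrow> nat \<times> nat \<Rightarrow> (nat \<times> nat) multiset" where
  "transitions n = (\<lambda>(i, j). replicate_mset i (i - 1, j) + replicate_mset (n - i) (i + 1, j)
     + replicate_mset j (i, j - 1) + replicate_mset (n + 1 - j) (i, j + 1))"

lemma image_mset_mset_set_eq_sum:
  "finite A \<Longrightarrow> image_mset f (mset_set A) = (\<Sum>a\<in>A. {#f a#})"
  by (induction A rule: finite_induct) auto

text \<open>
  With distributions kept as multisets of values, the sum over \<open>B\<close> is a double sum over \<open>A\<close> and \<open>C\<close>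
  whose inner sum depends on \<open>a\<close> only through \<open>stat a\<close>.  Hence the distribution on \<open>A\<close> and the law
  \<open>K\<close> determine the distribution on \<open>B\<close>; this is the induction step of the equidistribution.
\<close>

lemma distribution_of_extension:
  assumes "finite A" "finite C"
    and ext: "bij_betw (\<lambda>(a, c). ext a c) (A \<times> C) B"
    and law: "\<And>a. a \<in> A \<Longrightarrow> image_mset (\<lambda>c. stat' (ext a c)) (mset_set C) = K (stat a)"
  shows "image_mset stat' (mset_set B) = (\<Sum>s\<in>#image_mset stat (mset_set A). K s)"
proof -
  have "finite B"
    using ext assms(1,2) bij_betw_finite by blast
  then have "image_mset stat' (mset_set B) = (\<Sum>b\<in>B. {#stat' b#})"
    by (rule image_mset_mset_set_eq_sum)
  also have "\<dots> = (\<Sum>(a, c)\<in>A \<times> C. {#stat' (ext a c)#})"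
    using sum.reindex_bij_betw[OF ext, of "\<lambda>b. {#stat' b#}"]
    by (simp add: case_prod_unfold)
  also have "\<dots> = (\<Sum>a\<in>A. \<Sum>c\<in>C. {#stat' (ext a c)#})"
    by (simp add: sum.cartesian_product)
  also have "\<dots> = (\<Sum>a\<in>A. K (stat a))"
    using law \<open>finite C\<close> by (simp add: image_mset_mset_set_eq_sum)
  also have "\<dots> = (\<Sum>s\<in>#image_mset stat (mset_set A). K s)"
    by (simp add: sum_unfold_sum_mset multiset.map_comp comp_def)
  finally show ?thesis .
qed

lemma image_mset_mset_set_const:
  assumes "\<And>x. x \<in> A \<Longrightarrow> f x = y"
  shows "image_mset f (mset_set A) = replicate_mset (card A) y"
proof -
  have "image_mset f (mset_set A) = image_mset (\<lambda>_. y) (mset_set A)"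
    using assms by (cases "finite A") (auto intro!: image_mset_cong)
  then show ?thesis
    by (simp add: image_mset_const_eq)
qed

text \<open>
  Only three of the four kinds of extensions have to be counted: the size of the fourth is
  forced by the total \<open>2 * n + 1\<close>.
\<close>

lemma transitionsI:
  fixes n :: nat
  assumes sub: "P \<subseteq> {1..2 * n + 1}" "Q \<subseteq> {1..2 * n + 1}" "R \<subseteq> {1..2 * n + 1}"
    and disj: "P \<inter> Q = {}" "P \<inter> R = {}" "Q \<inter> R = {}"
    and cards: "card P = i" "card Q = n - i" "card R = j" "i \<le> n"
    and P: "\<And>c. c \<in> P \<Longrightarrow> F c = (i - 1, j)"
    and Q: "\<And>c. c \<in> Q \<Longrightarrow> F c = (i + 1, j)"
    and R: "\<And>c. c \<in> R \<Longrightarrow> F c = (i, j - 1)"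
    and rest: "\<And>c. c \<in> {1..2 * n + 1} - (P \<union> Q \<union> R) \<Longrightarrow> F c = (i, j + 1)"
  shows "image_mset F (mset_set {1..2 * n + 1}) = transitions n (i, j)"
proof -
  define S where "S = {1..2 * n + 1} - (P \<union> Q \<union> R)"
  have fin: "finite P" "finite Q" "finite R" "finite S"
    using sub by (auto intro: finite_subset simp: S_def)
  have "card (P \<union> Q \<union> R) = n + j"
    using fin disj cards by (simp add: card_Un_disjoint Int_Un_distrib2)
  moreover have "card S = card {1..2 * n + 1} - card (P \<union> Q \<union> R)"
    unfolding S_def using fin sub by (intro card_Diff_subset) auto
  ultimately have S: "card S = n + 1 - j"
    by simp
  have "{1..2 * n + 1} = P \<union> Q \<union> R \<union> S"
    using sub unfolding S_def by blast
  moreover have "(P \<union> Q \<union> R) \<inter> S = {}" "(P \<union> Q) \<inter> R = {}"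
    using disj unfolding S_def by blast+
  ultimately have "mset_set {1..2 * n + 1} = mset_set P + mset_set Q + mset_set R + mset_set S"
    using fin disj by (simp add: mset_set_Union)
  moreover have "image_mset F (mset_set S) = replicate_mset (n + 1 - j) (i, j + 1)"
    using image_mset_mset_set_const[of S F] rest S unfolding S_def by metis
  moreover have "image_mset F (mset_set P) = replicate_mset i (i - 1, j)"
    using image_mset_mset_set_const[of P F] P cards by metis
  moreover have "image_mset F (mset_set Q) = replicate_mset (n - i) (i + 1, j)"
    using image_mset_mset_set_const[of Q F] Q cards by metis
  moreover have "image_mset F (mset_set R) = replicate_mset j (i, j - 1)"
    using image_mset_mset_set_const[of R F] R cards by metis
  ultimately show ?thesis
    by (simp add: transitions_def)
qed

lemma count_image_mset_mset_set:
  assumes "finite A"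
  shows "count (image_mset f (mset_set A)) y = card {a \<in> A. f a = y}"
proof -
  have "count (image_mset f (mset_set A)) y = sum (count (mset_set A)) (f -` {y} \<inter> A)"
    using assms by (simp add: count_image_mset)
  also have "\<dots> = card (f -` {y} \<inter> A)"
    using assms by simp
  also have "f -` {y} \<inter> A = {a \<in> A. f a = y}"
    by auto
  finally show ?thesis .
qed

lemma card_evens: "card {v \<in> {1..2 * n + 1}. even v} = (n :: nat)"
proof -
  have "{v \<in> {1..2 * n + 1}. even v} = (*) 2 ` {1..n}"
    by (auto elim!: evenE)
  then show ?thesis
    by (simp add: card_image inj_on_def)
qed

section \<open>Trapezoidal words\<close>

definition odd_multiplicity :: "nat list \<Rightarrow> nat set" where
  "odd_multiplicity w = {v. odd (count_list w v)}"

lemma odd_multiplicity_subset: "odd_multiplicity w \<subseteq> set w"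
  using count_notin unfolding odd_multiplicity_def by fastforce

lemma odd_multiplicity_snoc:
  "odd_multiplicity (w @ [c]) =
    (if c \<in> odd_multiplicity w then odd_multiplicity w - {c} else insert c (odd_multiplicity w))"
  by (auto simp: odd_multiplicity_def split: if_splits)

definition word_stat :: "nat list \<Rightarrow> nat \<times> nat" where
  "word_stat w = (even_entries_odd_times w, odd_entries_odd_times w)"

lemma word_stat_eq:
  "word_stat w = (card {v \<in> odd_multiplicity w. even v}, card {v \<in> odd_multiplicity w. odd v})"
proof -
  have "{v \<in> set w. even v \<and> odd (count_list w v)} = {v \<in> odd_multiplicity w. even v}"
    "{v \<in> set w. odd v \<and> odd (count_list w v)} = {v \<in> odd_multiplicity w. odd v}"
    using odd_multiplicity_subset[of w] by (auto simp: odd_multiplicity_def)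
  then show ?thesis
    by (simp add: word_stat_def even_entries_odd_times_def odd_entries_odd_times_def)
qed

lemma word_stat_snoc:
  "word_stat (w @ [c]) =
    (let (i, j) = word_stat w in
      if even c then if c \<in> odd_multiplicity w then (i - 1, j) else (i + 1, j)
      else if c \<in> odd_multiplicity w then (i, j - 1) else (i, j + 1))"
proof -
  have fin: "finite (odd_multiplicity w)"
    using odd_multiplicity_subset finite_subset by blast
  have del: "{v \<in> S - {c}. p v} = (if p c then {v \<in> S. p v} - {c} else {v \<in> S. p v})"
    and ins: "{v \<in> insert c S. p v} = (if p c then insert c {v \<in> S. p v} else {v \<in> S. p v})"
    for S :: "nat set" and p
    by auto
  show ?thesis
    using fin unfolding word_stat_eq odd_multiplicity_snoc
    by (auto simp del: Diff_iff insert_iff simp: del ins)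
qed

lemma trapezoidal_words_0: "trapezoidal_words 0 = {[]}"
  by (auto simp: trapezoidal_words_def)

lemma snoc_trapezoidal_words:
  "bij_betw (\<lambda>(w, c). w @ [c]) (trapezoidal_words n \<times> {1..2 * n + 1}) (trapezoidal_words (Suc n))"
proof (rule bij_betw_byWitness[where f' = "\<lambda>w. (butlast w, last w)"])
  show "(\<lambda>w. (butlast w, last w)) ` trapezoidal_words (Suc n)
      \<subseteq> trapezoidal_words n \<times> {1..2 * n + 1}"
    by (auto simp: trapezoidal_words_def nth_butlast last_conv_nth
        simp flip: length_greater_0_conv)
next
  show "(\<lambda>(w, c). w @ [c]) ` (trapezoidal_words n \<times> {1..2 * n + 1}) \<subseteq> trapezoidal_words (Suc n)"
    by (auto simp: trapezoidal_words_def nth_append less_Suc_eq)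
next
  show "\<forall>w\<in>trapezoidal_words (Suc n). (\<lambda>(w, c). w @ [c]) (butlast w, last w) = w"
    by (auto simp: trapezoidal_words_def intro!: append_butlast_last_id)
qed auto

lemma finite_trapezoidal_words: "finite (trapezoidal_words n)"
proof (induction n)
  case (Suc n)
  then show ?case
    using snoc_trapezoidal_words[of n] bij_betw_finite by blast
qed (simp add: trapezoidal_words_0)

lemma set_trapezoidal_word:
  assumes "w \<in> trapezoidal_words n"
  shows "set w \<subseteq> {1..2 * n + 1}"
  using assms by (fastforce simp: trapezoidal_words_def in_set_conv_nth)

lemma word_transitions:
  assumes "w \<in> trapezoidal_words n"
  shows "image_mset (\<lambda>c. word_stat (w @ [c])) (mset_set {1..2 * n + 1})
    = transitions n (word_stat w)"
proof -
  define P where "P = {v \<in> odd_multiplicity w. even v}"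
  define Q where "Q = {v \<in> {1..2 * n + 1}. even v} - P"
  define R where "R = {v \<in> odd_multiplicity w. odd v}"
  have sub: "odd_multiplicity w \<subseteq> {1..2 * n + 1}"
    using odd_multiplicity_subset set_trapezoidal_word[OF assms] by blast
  have PE: "P \<subseteq> {v \<in> {1..2 * n + 1}. even v}"
    using sub by (auto simp: P_def)
  have "finite P"
    by (rule finite_subset[OF PE]) simp
  then have Q: "card Q = n - card P"
    unfolding Q_def using PE card_evens by (simp add: card_Diff_subset)
  have P: "card P \<le> n"
    using card_mono[OF _ PE] card_evens[of n] by simp
  have stat: "word_stat w = (card P, card R)"
    by (simp add: word_stat_eq P_def R_def)
  show ?thesis
    unfolding stat
    by (rule transitionsI[where P = P and Q = Q and R = R])
      (use sub P Q in \<open>auto simp: word_stat_snoc stat P_def Q_def R_def\<close>)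
qed

section \<open>Perfect matchings as involutions\<close>

text \<open>
  A perfect matching of \<open>A\<close> is the same as an involution whose set of non-fixed points is \<open>A\<close>.
  Fixing all points outside \<open>A\<close> makes the function unique; the inserted points are then fixed
  points of the function that is extended.
\<close>

definition involutions_moving :: "nat set \<Rightarrow> (nat \<Rightarrow> nat) set" where
  "involutions_moving A = {f. (\<forall>x. f (f x) = x) \<and> (\<forall>x. f x \<noteq> x \<longleftrightarrow> x \<in> A)}"

lemma involutions_movingD:
  assumes "f \<in> involutions_moving A"
  shows "f (f x) = x" "x \<in> A \<Longrightarrow> f x \<noteq> x" "x \<notin> A \<Longrightarrow> f x = x" "f x \<in> A \<longleftrightarrow> x \<in> A"
proof -
  show "f (f x) = x" "x \<in> A \<Longrightarrow> f x \<noteq> x" "x \<notin> A \<Longrightarrow> f x = x"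
    using assms by (auto simp: involutions_moving_def)
  have inv: "\<And>y. f (f y) = y" and moves: "\<And>y. y \<in> A \<longleftrightarrow> f y \<noteq> y"
    using assms by (auto simp: involutions_moving_def)
  show "f x \<in> A \<longleftrightarrow> x \<in> A"
    unfolding moves inv by auto
qed

definition orbits_on :: "nat set \<Rightarrow> (nat \<Rightarrow> nat) \<Rightarrow> nat set set" where
  "orbits_on A f = (\<lambda>x. {x, f x}) ` A"

lemma orbits_on_partition:
  assumes "f \<in> involutions_moving A"
  shows "partition_on A (orbits_on A f)" "\<forall>e\<in>orbits_on A f. card e = 2"
proof -
  note f = involutions_movingD[OF assms]
  show "partition_on A (orbits_on A f)"
  proof (rule partition_onI)
    show "\<Union> (orbits_on A f) = A"
      using f(4) by (auto simp: orbits_on_def)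
    show "{} \<notin> orbits_on A f"
      by (auto simp: orbits_on_def)
    show "disjnt p q" if "p \<in> orbits_on A f" "q \<in> orbits_on A f" "p \<noteq> q" for p q
      using that f(1) unfolding orbits_on_def disjnt_def
      by (smt (verit) disjoint_iff doubleton_eq_iff imageE insertE singletonD)
  qed
  show "\<forall>e\<in>orbits_on A f. card e = 2"
    using f(2) by (auto simp: orbits_on_def card_2_iff)
qed

lemma orbits_on_inj: "inj_on (orbits_on A) (involutions_moving A)"
proof (rule inj_onI, rule ext)
  fix f g x
  assume f: "f \<in> involutions_moving A" and g: "g \<in> involutions_moving A"
    and eq: "orbits_on A f = orbits_on A g"
  show "f x = g x"
  proof (cases "x \<in> A")
    case True
    then have "{x, f x} \<in> orbits_on A g"
      using eq by (auto simp: orbits_on_def)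
    then obtain y where "{x, f x} = {y, g y}"
      by (auto simp: orbits_on_def)
    then show ?thesis
      using involutions_movingD[OF g] by (metis doubleton_eq_iff)
  next
    case False
    then show ?thesis
      using involutions_movingD(3) f g by metis
  qed
qed

text \<open>The involution is recovered by sending each point to the other element of its block.\<close>

lemma orbits_on_surj:
  assumes part: "partition_on A M" and two: "\<forall>e\<in>M. card e = 2"
  shows "\<exists>f\<in>involutions_moving A. orbits_on A f = M"
proof -
  have ex: "\<exists>y. y \<noteq> x \<and> {x, y} \<in> M" if "x \<in> A" for x
  proof -
    obtain e where e: "e \<in> M" "x \<in> e"
      using part \<open>x \<in> A\<close> by (auto simp: partition_on_def)
    then obtain a b where ab: "e = {a, b}" "a \<noteq> b"
      using two by (auto simp: card_2_iff)
    show ?thesis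
    proof (cases "x = a")
      case True
      then show ?thesis using e ab by auto
    next
      case False
      then have "e = {x, a}" using e ab by auto
      then show ?thesis using e False by auto
    qed
  qed
  have same: "e = e'" if "e \<in> M" "e' \<in> M" "x \<in> e" "x \<in> e'" for e e' x
    using part that by (auto simp: partition_on_def disjoint_def)
  define f where "f x = (if x \<in> A then SOME y. y \<noteq> x \<and> {x, y} \<in> M else x)" for x
  have f: "f x \<noteq> x" "{x, f x} \<in> M" if "x \<in> A" for x
    using someI_ex[OF ex[OF that]] that by (simp_all add: f_def)
  have sub: "e \<subseteq> A" if "e \<in> M" for e
    using part that by (auto simp: partition_on_def)
  have "f (f x) = x" for x
  proof (cases "x \<in> A")
    case True
    then have "f x \<in> A"
      using f(2) sub by blast
    then have "{f x, f (f x)} = {x, f x}"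
      using f(2) True by (intro same[of _ _ "f x"]) auto
    then show ?thesis
      using f(1)[OF \<open>f x \<in> A\<close>] by (metis doubleton_eq_iff)
  qed (simp add: f_def)
  then have "f \<in> involutions_moving A"
    using f(1) by (auto simp: involutions_moving_def f_def)
  moreover have "orbits_on A f = M"
  proof
    show "orbits_on A f \<subseteq> M"
      using f(2) by (auto simp: orbits_on_def)
    show "M \<subseteq> orbits_on A f"
    proof
      fix e assume "e \<in> M"
      then obtain x where "x \<in> e"
        using two by (auto simp: card_2_iff)
      then have "x \<in> A" "e = {x, f x}"
        using sub \<open>e \<in> M\<close> f(2) same[of e "{x, f x}" x] by auto
      then show "e \<in> orbits_on A f"
        by (auto simp: orbits_on_def)
    qed
  qed
  ultimately show ?thesis by blast
qed

lemma orbits_on_bij: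
  "bij_betw (orbits_on {1..2 * n}) (involutions_moving {1..2 * n}) (perfect_matchings n)"
  unfolding bij_betw_def
proof
  show "orbits_on {1..2 * n} ` involutions_moving {1..2 * n} = perfect_matchings n"
  proof
    show "orbits_on {1..2 * n} ` involutions_moving {1..2 * n} \<subseteq> perfect_matchings n"
      unfolding perfect_matchings_def using orbits_on_partition by blast
    show "perfect_matchings n \<subseteq> orbits_on {1..2 * n} ` involutions_moving {1..2 * n}"
      unfolding perfect_matchings_def using orbits_on_surj by blast
  qed
qed (rule orbits_on_inj)

lemma finite_perfect_matchings: "finite (perfect_matchings n)"
proof (rule finite_subset)
  show "perfect_matchings n \<subseteq> Pow (Pow {1..2 * n})"
    by (auto simp: perfect_matchings_def partition_on_def)
qed simp

definition even_to_odd :: "(nat \<Rightarrow> nat) \<Rightarrow> nat set" where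
  "even_to_odd f = {p. even p \<and> odd (f p) \<and> p < f p}"

definition odd_to_even :: "(nat \<Rightarrow> nat) \<Rightarrow> nat set" where
  "odd_to_even f = {p. odd p \<and> even (f p) \<and> p < f p}"

definition matching_stat :: "nat set set \<Rightarrow> nat \<times> nat" where
  "matching_stat M = (even_to_odd_matches M, odd_to_even_matches M)"

definition involution_stat :: "(nat \<Rightarrow> nat) \<Rightarrow> nat \<times> nat" where
  "involution_stat f = (card (even_to_odd f), card (odd_to_even f))"

text \<open>A match is determined by its smaller end, so matches can be counted by their smaller ends.\<close>

lemma card_orbits_on:
  assumes f: "f \<in> involutions_moving A"
  shows "card {e \<in> orbits_on A f. \<exists>a b. e = {a, b} \<and> a < b \<and> r a b} = card {p. p < f p \<and> r p (f p)}"
proof -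
  have "inj_on (\<lambda>p. {p, f p}) {p. p < f p \<and> r p (f p)}"
    by (auto simp: inj_on_def doubleton_eq_iff)
  moreover have "(\<lambda>p. {p, f p}) ` {p. p < f p \<and> r p (f p)}
      = {e \<in> orbits_on A f. \<exists>a b. e = {a, b} \<and> a < b \<and> r a b}" (is "?L = ?R")
  proof
    show "?L \<subseteq> ?R"
    proof
      fix e assume "e \<in> ?L"
      then obtain p where p: "e = {p, f p}" "p < f p" "r p (f p)" by auto
      then have "p \<in> A" using involutions_movingD(3)[OF f, of p] by auto
      then show "e \<in> ?R" using p by (auto simp: orbits_on_def)
    qed
    show "?R \<subseteq> ?L"
    proof
      fix e assume "e \<in> ?R"
      then obtain a b x where e: "e = {a, b}" "a < b" "r a b" "e = {x, f x}"
        by (auto simp: orbits_on_def)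
      then have "b = f a"
        using involutions_movingD(1)[OF f] by (auto simp: doubleton_eq_iff)
      then show "e \<in> ?L" using e by auto
    qed
  qed
  ultimately show ?thesis
    by (metis (no_types, lifting) card_image)
qed

lemma matching_stat_orbits_on:
  assumes "f \<in> involutions_moving A"
  shows "matching_stat (orbits_on A f) = involution_stat f"
  using card_orbits_on[OF assms, of "\<lambda>a b. even a \<and> odd b"]
    card_orbits_on[OF assms, of "\<lambda>a b. odd a \<and> even b"]
  by (simp add: matching_stat_def involution_stat_def even_to_odd_matches_def
      odd_to_even_matches_def even_to_odd_def odd_to_even_def conj_ac)

section \<open>Inserting two points into a perfect matching\<close>

text \<open>
  The choice \<open>c = 2 * n + 1\<close> stands for matching the new points with each other; any other choice
  is the end of the split match that goes to \<open>2 * n + 1\<close>, so that each match can be split in two ways.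
\<close>

definition insert_pair :: "nat \<Rightarrow> (nat \<Rightarrow> nat) \<Rightarrow> nat \<Rightarrow> nat \<Rightarrow> nat" where
  "insert_pair n f c =
    (if c = 2 * n + 1 then f(2 * n + 1 := 2 * n + 2, 2 * n + 2 := 2 * n + 1)
     else f(c := 2 * n + 1, 2 * n + 1 := c, f c := 2 * n + 2, 2 * n + 2 := f c))"

text \<open>
  The order of the updates matters: if the two last points are matched with each other, the first
  two updates concern these points, and are overridden by the last two.
\<close>

definition delete_pair :: "nat \<Rightarrow> (nat \<Rightarrow> nat) \<Rightarrow> nat \<Rightarrow> nat" where
  "delete_pair n g =
    g(g (2 * n + 1) := g (2 * n + 2), g (2 * n + 2) := g (2 * n + 1),
      2 * n + 1 := 2 * n + 1, 2 * n + 2 := 2 * n + 2)"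

text \<open>
  The partner of \<open>2 * n + 1\<close> is the choice made, except that the partner \<open>2 * n + 2\<close> encodes the
  choice \<open>2 * n + 1\<close>; the minimum covers both cases.
\<close>

definition pair_choice :: "nat \<Rightarrow> (nat \<Rightarrow> nat) \<Rightarrow> nat" where
  "pair_choice n g = min (g (2 * n + 1)) (2 * n + 1)"

lemma insert_pair_bij:
  "bij_betw (\<lambda>(f, c). insert_pair n f c) (involutions_moving {1..2 * n} \<times> {1..2 * n + 1})
    (involutions_moving {1..2 * Suc n})"
proof (rule bij_betw_byWitness[where f' = "\<lambda>g. (delete_pair n g, pair_choice n g)"])
  show "\<forall>x\<in>involutions_moving {1..2 * n} \<times> {1..2 * n + 1}.
      (\<lambda>g. (delete_pair n g, pair_choice n g)) ((\<lambda>(f, c). insert_pair n f c) x) = x"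
  proof
    fix x assume "x \<in> involutions_moving {1..2 * n} \<times> {1..2 * n + 1}"
    then obtain f c where x: "x = (f, c)"
      and f: "f \<in> involutions_moving {1..2 * n}" and c: "c \<in> {1..2 * n + 1}"
      by blast
    have new: "f (2 * n + 1) = 2 * n + 1" "f (2 * n + 2) = 2 * n + 2"
      by (rule involutions_movingD(3)[OF f], simp)+
    note f' = involutions_movingD[OF f]
    have "delete_pair n (insert_pair n f c) = f"
    proof (cases "c = 2 * n + 1")
      case True
      then show ?thesis using new by (auto simp: delete_pair_def insert_pair_def fun_eq_iff)
    next
      case False
      then have "c \<in> {1..2 * n}" "f c \<in> {1..2 * n}" "f c \<noteq> c" using c f'(2,4) by auto
      then show ?thesis using new False f'(1) by (auto simp: delete_pair_def insert_pair_def fun_eq_iff)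
    qed
    moreover have "pair_choice n (insert_pair n f c) = c"
    proof (cases "c = 2 * n + 1")
      case False
      then have "c \<in> {1..2 * n}" "f c \<in> {1..2 * n}" "f c \<noteq> c" using c f'(2,4) by auto
      then show ?thesis using False by (auto simp: pair_choice_def insert_pair_def)
    qed (simp add: pair_choice_def insert_pair_def)
    ultimately show "(\<lambda>g. (delete_pair n g, pair_choice n g)) ((\<lambda>(f, c). insert_pair n f c) x) = x"
      by (simp add: x)
  qed
next
  show "(\<lambda>(f, c). insert_pair n f c) ` (involutions_moving {1..2 * n} \<times> {1..2 * n + 1})
      \<subseteq> involutions_moving {1..2 * Suc n}"
  proof clarify
    fix f c assume f: "f \<in> involutions_moving {1..2 * n}" and c: "c \<in> {1..2 * n + 1}"
    have new: "f (2 * n + 1) = 2 * n + 1" "f (2 * n + 2) = 2 * n + 2"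
      by (rule involutions_movingD(3)[OF f], simp)+
    note f' = involutions_movingD[OF f]
    have grow: "x \<in> {1..2 * Suc n} \<longleftrightarrow> x \<in> {1..2 * n} \<or> x = 2 * n + 1 \<or> x = 2 * n + 2" for x
      by auto
    \<comment> \<open>Oriented as rewrite rules, these decide whether \<open>f x\<close> is one of the updated points.\<close>
    have old: "f x = 2 * n + 1 \<longleftrightarrow> x = 2 * n + 1" "f x = 2 * n + 2 \<longleftrightarrow> x = 2 * n + 2"
      "f x = c \<longleftrightarrow> x = f c" "f x = f c \<longleftrightarrow> x = c" for x
      using new f'(1) by metis+
    have moves: "f x \<noteq> x \<longleftrightarrow> x \<in> {1..2 * n}" for x
      using f'(2,3) by blast
    show "insert_pair n f c \<in> involutions_moving {1..2 * Suc n}"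
    proof (cases "c = 2 * n + 1")
      case True
      then show ?thesis
        using moves unfolding involutions_moving_def grow insert_pair_def
        by (simp add: old f'(1) del: atLeastAtMost_iff One_nat_def add_2_eq_Suc')
    next
      case False
      then have cn: "c \<in> {1..2 * n}" "f c \<in> {1..2 * n}" "f c \<noteq> c"
        using c f'(2,4) by auto
      then have "c \<noteq> 2 * n + 1" "c \<noteq> 2 * n + 2" "2 * n + 1 \<noteq> f c" "2 * n + 2 \<noteq> f c"
        by auto
      with cn show ?thesis
        using moves unfolding involutions_moving_def grow insert_pair_def
        by (simp add: old f'(1) del: atLeastAtMost_iff One_nat_def add_2_eq_Suc')
    qed
  qed
next
  have inverse: "insert_pair n (delete_pair n g) (pair_choice n g) = g"
    and delete: "delete_pair n g \<in> involutions_moving {1..2 * n}"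
    and choice: "pair_choice n g \<in> {1..2 * n + 1}"
    if g: "g \<in> involutions_moving {1..2 * Suc n}" for g
  proof -
    note g' = involutions_movingD[OF g]
    have shrink: "x \<in> {1..2 * n} \<longleftrightarrow> x \<in> {1..2 * Suc n} \<and> x \<noteq> 2 * n + 1 \<and> x \<noteq> 2 * n + 2" for x
      by auto
    have new: "2 * n + 1 \<in> {1..2 * Suc n}" "2 * n + 2 \<in> {1..2 * Suc n}"
      by auto
    have r: "g (2 * n + 1) \<in> {1..2 * Suc n}" "g (2 * n + 2) \<in> {1..2 * Suc n}"
      "g (2 * n + 1) \<noteq> 2 * n + 1" "g (2 * n + 2) \<noteq> 2 * n + 2"
      using g'(2,4) new by blast+
    have swap: "g (2 * n + 1) = 2 * n + 2 \<longleftrightarrow> g (2 * n + 2) = 2 * n + 1"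
      "g (2 * n + 1) \<noteq> g (2 * n + 2)"
      using g'(1)[of "2 * n + 1"] g'(1)[of "2 * n + 2"] by auto
    show "pair_choice n g \<in> {1..2 * n + 1}"
      using r by (auto simp: pair_choice_def)
    have choice: "pair_choice n g = (if g (2 * n + 1) = 2 * n + 2 then 2 * n + 1 else g (2 * n + 1))"
      using r by (auto simp: pair_choice_def)
    show "insert_pair n (delete_pair n g) (pair_choice n g) = g"
      unfolding choice insert_pair_def delete_pair_def
      using r swap g'(1) by (auto simp: fun_eq_iff)
    have old: "g x = 2 * n + 1 \<longleftrightarrow> x = g (2 * n + 1)" "g x = 2 * n + 2 \<longleftrightarrow> x = g (2 * n + 2)"
      "g x = g (2 * n + 1) \<longleftrightarrow> x = 2 * n + 1" "g x = g (2 * n + 2) \<longleftrightarrow> x = 2 * n + 2" for x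
      using g'(1) by metis+
    have moves: "g x \<noteq> x \<longleftrightarrow> x \<in> {1..2 * Suc n}" for x
      using g'(2,3) by blast
    show "delete_pair n g \<in> involutions_moving {1..2 * n}"
      unfolding involutions_moving_def shrink delete_pair_def moves[symmetric]
      using r swap by (simp add: old g'(1) del: One_nat_def add_2_eq_Suc')
  qed
  show "\<forall>g\<in>involutions_moving {1..2 * Suc n}.
      (\<lambda>(f, c). insert_pair n f c) (delete_pair n g, pair_choice n g) = g"
    using inverse by simp
  show "(\<lambda>g. (delete_pair n g, pair_choice n g)) ` involutions_moving {1..2 * Suc n}
      \<subseteq> involutions_moving {1..2 * n} \<times> {1..2 * n + 1}"
    using delete choice by blast
qed

lemma insert_new_match:
  assumes f: "f \<in> involutions_moving {1..2 * n}"
  shows "even_to_odd (insert_pair n f (2 * n + 1)) = even_to_odd f"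
    "odd_to_even (insert_pair n f (2 * n + 1)) = insert (2 * n + 1) (odd_to_even f)"
proof -
  have "f (2 * n + 1) = 2 * n + 1" "f (2 * n + 2) = 2 * n + 2"
    by (rule involutions_movingD(3)[OF f], simp)+
  then show "even_to_odd (insert_pair n f (2 * n + 1)) = even_to_odd f"
    "odd_to_even (insert_pair n f (2 * n + 1)) = insert (2 * n + 1) (odd_to_even f)"
    by (auto simp: insert_pair_def even_to_odd_def odd_to_even_def)
qed

text \<open>
  The new points are larger than all old ones, so the old end is the smaller end of each new match.
  Since \<open>2 * n + 1\<close> is odd, only the match of \<open>c\<close> can be even-to-odd; since \<open>2 * n + 2\<close> is
  even, only the match of \<open>f c\<close> can be odd-to-even.
\<close>

lemma insert_split_match:
  assumes f: "f \<in> involutions_moving {1..2 * n}" and c: "c \<in> {1..2 * n}"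
  shows "even_to_odd (insert_pair n f c)
      = (even_to_odd f - {c, f c}) \<union> (if even c then {c} else {})"
    "odd_to_even (insert_pair n f c)
      = (odd_to_even f - {c, f c}) \<union> (if odd (f c) then {f c} else {})"
proof -
  have new: "f (2 * n + 1) = 2 * n + 1" "f (2 * n + 2) = 2 * n + 2"
    by (rule involutions_movingD(3)[OF f], simp)+
  have c': "f c \<in> {1..2 * n}" "f c \<noteq> c"
    using involutions_movingD[OF f] c by auto
  show "even_to_odd (insert_pair n f c)
      = (even_to_odd f - {c, f c}) \<union> (if even c then {c} else {})"
    using new c c' by (auto simp: insert_pair_def even_to_odd_def split: if_splits)
  show "odd_to_even (insert_pair n f c)
      = (odd_to_even f - {c, f c}) \<union> (if odd (f c) then {f c} else {})"
    using new c c' by (auto simp: insert_pair_def odd_to_even_def split: if_splits)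
qed

text \<open>
  The even-to-odd matches enter through both of their ends.  Choosing the larger end destroys the
  match, and these choices form \<open>P\<close>.  The smaller ends are the even points missing from \<open>Q\<close>:
  choosing such a \<open>c\<close> only replaces its match by the even-to-odd match \<open>{c, 2 * n + 1}\<close>, while
  its former partner gains an odd-to-even match.
\<close>

lemma matching_transitions:
  assumes f: "f \<in> involutions_moving {1..2 * n}"
  shows "image_mset (\<lambda>c. involution_stat (insert_pair n f c)) (mset_set {1..2 * n + 1})
    = transitions n (involution_stat f)"
proof -
  note f' = involutions_movingD[OF f]
  define P where "P = {c. odd c \<and> even (f c) \<and> f c < c}"
  define Q where "Q = {v \<in> {1..2 * n + 1}. even v} - even_to_odd f"
  let ?EO = "even_to_odd f" and ?OE = "odd_to_even f"
  have moved: "x \<in> {1..2 * n}" if "f x \<noteq> x" for x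
    using that f'(3) by blast
  have sub: "P \<subseteq> {1..2 * n}" "?EO \<subseteq> {1..2 * n}" "?OE \<subseteq> {1..2 * n}"
    using moved by (auto simp: P_def even_to_odd_def odd_to_even_def)
  then have fin: "finite ?EO" "finite ?OE"
    by (auto intro: finite_subset)
  have EO: "?EO \<subseteq> {v \<in> {1..2 * n + 1}. even v}"
    using sub by (auto simp: even_to_odd_def)
  have Q: "card Q = n - card ?EO"
    unfolding Q_def using EO fin card_evens by (simp add: card_Diff_subset)
  have le: "card ?EO \<le> n"
    using card_mono[OF _ EO] card_evens[of n] by simp
  \<comment> \<open>\<open>f\<close> exchanges the smaller and the larger ends of even-to-odd matches.\<close>
  have "bij_betw f ?EO P"
    by (rule bij_betw_byWitness[where f' = f])
      (auto simp: P_def even_to_odd_def f'(1))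
  then have P: "card P = card ?EO"
    by (simp add: bij_betw_same_card)
  show ?thesis
    unfolding involution_stat_def[of f]
  proof (rule transitionsI[where P = P and Q = Q and R = ?OE])
    show "P \<subseteq> {1..2 * n + 1}" "Q \<subseteq> {1..2 * n + 1}" "?OE \<subseteq> {1..2 * n + 1}"
      using sub by (auto simp: Q_def)
    show "P \<inter> Q = {}" "P \<inter> ?OE = {}" "Q \<inter> ?OE = {}"
      by (auto simp: P_def Q_def odd_to_even_def)
    show "card P = card ?EO" "card Q = n - card ?EO" "card ?OE = card ?OE" "card ?EO \<le> n"
      using P Q le by auto
  next
    fix c assume c: "c \<in> P"
    then have cn: "c \<in> {1..2 * n}" and fc: "f c \<in> ?EO" and "c \<notin> ?OE" "c \<notin> ?EO" "f c \<notin> ?OE"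
      using sub f'(1) by (auto simp: P_def even_to_odd_def odd_to_even_def)
    then show "involution_stat (insert_pair n f c) = (card ?EO - 1, card ?OE)"
      using c fin by (simp add: involution_stat_def insert_split_match[OF f cn] P_def)
  next
    fix c assume c: "c \<in> Q"
    then have cn: "c \<in> {1..2 * n}"
      by (auto simp: Q_def le_Suc_eq)
    have "f c \<noteq> c" using f' cn by blast
    have "even_to_odd (insert_pair n f c) = insert c ?EO"
      using c f'(1) \<open>f c \<noteq> c\<close> unfolding insert_split_match[OF f cn]
      by (auto simp: Q_def even_to_odd_def)
    moreover have "odd_to_even (insert_pair n f c) = ?OE"
      using c f'(1) \<open>f c \<noteq> c\<close> unfolding insert_split_match[OF f cn]
      by (auto simp: Q_def even_to_odd_def odd_to_even_def)
    ultimately show "involution_stat (insert_pair n f c) = (card ?EO + 1, card ?OE)"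
      using c fin by (simp add: involution_stat_def Q_def)
  next
    fix c assume c: "c \<in> ?OE"
    then have cn: "c \<in> {1..2 * n}" and "f c \<notin> ?EO" "c \<notin> ?EO" "f c \<notin> ?OE"
      using sub f'(1) by (auto simp: even_to_odd_def odd_to_even_def)
    then show "involution_stat (insert_pair n f c) = (card ?EO, card ?OE - 1)"
      using c fin
      by (simp add: involution_stat_def insert_split_match[OF f cn]) (simp add: odd_to_even_def)
  next
    fix c assume c: "c \<in> {1..2 * n + 1} - (P \<union> Q \<union> ?OE)"
    show "involution_stat (insert_pair n f c) = (card ?EO, card ?OE + 1)"
    proof (cases "c = 2 * n + 1")
      case True
      moreover have "2 * n + 1 \<notin> ?OE"
        using sub by auto
      ultimately show ?thesis
        using fin insert_new_match[OF f] by (simp add: involution_stat_def)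
    next
      case False
      then have cn: "c \<in> {1..2 * n}"
        using c by auto
      have "f c \<noteq> c" using f' cn by blast
      then have "odd (f c)" and new: "f c \<notin> ?OE"
        using c f'(1) by (auto simp: P_def Q_def even_to_odd_def odd_to_even_def)
      have "even_to_odd (insert_pair n f c) = ?EO"
        using c f'(1) \<open>odd (f c)\<close> unfolding insert_split_match[OF f cn]
        by (auto simp: Q_def even_to_odd_def)
      moreover have "odd_to_even (insert_pair n f c) = insert (f c) ?OE"
        using c f'(1) \<open>odd (f c)\<close> unfolding insert_split_match[OF f cn]
        by (auto simp: Q_def even_to_odd_def odd_to_even_def)
      ultimately show ?thesis
        using new fin by (simp add: involution_stat_def)
    qed
  qed
qed

section \<open>Equidistribution\<close>

lemma distribution_eq:
  "image_mset involution_stat (mset_set (involutions_moving {1..2 * n}))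
    = image_mset word_stat (mset_set (trapezoidal_words n))"
proof (induction n)
  case 0
  have "involutions_moving {1..2 * 0} = {id}"
    by (auto simp: involutions_moving_def)
  then show ?case
    by (simp add: trapezoidal_words_0 involution_stat_def even_to_odd_def odd_to_even_def
        word_stat_eq odd_multiplicity_def)
next
  case (Suc n)
  have fin: "finite (involutions_moving {1..2 * n})"
    using orbits_on_bij finite_perfect_matchings bij_betw_finite by blast
  have "image_mset involution_stat (mset_set (involutions_moving {1..2 * Suc n}))
      = (\<Sum>s\<in>#image_mset involution_stat (mset_set (involutions_moving {1..2 * n})). transitions n s)"
    by (rule distribution_of_extension[OF fin finite_atLeastAtMost insert_pair_bij])
      (rule matching_transitions)
  also have "\<dots> = (\<Sum>s\<in>#image_mset word_stat (mset_set (trapezoidal_words n)). transitions n s)"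
    using Suc.IH by simp
  also have "\<dots> = image_mset word_stat (mset_set (trapezoidal_words (Suc n)))"
    by (rule distribution_of_extension[OF finite_trapezoidal_words finite_atLeastAtMost
          snoc_trapezoidal_words, symmetric])
      (rule word_transitions)
  finally show ?case .
qed

theorem corollary18:
  fixes n :: nat
  assumes "n \<ge> 1"
  shows "\<forall>i j :: nat.
    card {M \<in> perfect_matchings n. even_to_odd_matches M = i \<and> odd_to_even_matches M = j} =
    card {w \<in> trapezoidal_words n. even_entries_odd_times w = i \<and> odd_entries_odd_times w = j}"
proof (intro allI)
  fix i j
  let ?I = "involutions_moving {1..2 * n}"
  have "image_mset matching_stat (mset_set (perfect_matchings n))
      = image_mset (matching_stat \<circ> orbits_on {1..2 * n}) (mset_set ?I)"
    using orbits_on_bij[of n] image_mset_mset_set[of "orbits_on {1..2 * n}" ?I]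
    by (simp add: bij_betw_def flip: multiset.map_comp)
  also have "\<dots> = image_mset involution_stat (mset_set ?I)"
    by (intro image_mset_cong)
      (metis comp_apply elem_mset_set empty_iff matching_stat_orbits_on mset_set.infinite set_mset_empty)
  finally have "image_mset matching_stat (mset_set (perfect_matchings n))
      = image_mset word_stat (mset_set (trapezoidal_words n))"
    using distribution_eq by simp
  then have "card {M \<in> perfect_matchings n. matching_stat M = (i, j)}
      = card {w \<in> trapezoidal_words n. word_stat w = (i, j)}"
    using count_image_mset_mset_set[OF finite_perfect_matchings]
      count_image_mset_mset_set[OF finite_trapezoidal_words] by metis
  then show "card {M \<in> perfect_matchings n. even_to_odd_matches M = i \<and> odd_to_even_matches M = j}
      = card {w \<in> trapezoidal_words n. even_entries_odd_times w = i \<and> odd_entries_odd_times w = j}"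
    by (simp add: matching_stat_def word_stat_def)
qed

end
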